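(* Let $\varrho\in\mathcal{R}_p(1)$. Then: (a) the map $f_\varrho:\mathrm{CExt}\mathbf{E}\to\mathrm{CExt}\mathbf{E}$, $f_\varrho(\mathbf{S})=\mathbf{S}_\varrho:=\{\varphi*\varrho:\varphi\in\mathbf{S}\}$, is well defined (i.e. $\mathbf{S}_\varrho$, closed under $\approx$, is again a classical modal logic) and is a lattice automorphism of $\mathrm{CExt}\mathbf{E}$; (b) the set $\mathcal{A}_p(1)=\{f_\varrho:\varrho\in\mathcal{R}_p(1)\}$ is a group (under composition of maps) of automorphisms of $\mathrm{CExt}\mathbf{E}$, and it is isomorphic to the symmetric group $\mathrm{S}_4$.
   Context: Language: propositional variables $p_1,p_2,\dots$, constants $0$ (falsum) and $1$ (verum), connectives $\neg,\vee$ (with $\wedge,\to,\leftrightarrow$ as the usual abbreviations) and one modal operator $\lozenge$; $\square\varphi$ abbreviates $\neg\lozenge\neg\varphi$. The minimal classical modal logic $\mathbf{E}$ is the smallest set of formulas containing all propositional tautologies and closed under modus ponens (MP), uniform substitution (US) and the congruence rule RE: from $\varphi\leftrightarrow\psi$ infer $\lozenge\varphi\leftrightarrow\lozenge\psi$. A classical modal logic is a set of formulas containing $\mathbf{E}$ and closed under MP, US and RE; $\mathrm{CExt}\mathbf{E}$ is the set of all classical modal logics (including the inconsistent logic $\mathbf{F}$ of all formulas), ordered by inclusion; it is a lattice whose meet is $\mathbf{S}'\cap\mathbf{S}''$ and whose join is the closure of $\mathbf{S}'\cup\mathbf{S}''$ under MP, US and RE. Write $\varphi\approx\psi$ if $\vdash_{\mathbf{E}}\varphi\leftrightarrow\psi$.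 Uniform replacements (URs): a UR is a formula $\rho(e)$ of modal degree at most 1 in the single variable $e$ (considered up to $\approx$). For any formula $\varphi$, the formula $\varphi*\rho$ is defined recursively by: $0*\rho=0$, $1*\rho=1$, $p_i*\rho=p_i$, $(\psi\vee\theta)*\rho=(\psi*\rho)\vee(\theta*\rho)$, $(\neg\psi)*\rho=\neg(\psi*\rho)$, $(\lozenge\psi)*\rho=\rho(\psi*\rho)$ (the result of substituting $\psi*\rho$ for $e$ in $\rho(e)$); abbreviated connectives and $\square$ are first expanded. The composition of URs is $\rho\rho':=\rho*\rho'$ (the UR $\rho'$ applied to the formula $\rho(e)$). $\mathcal{R}_p(1)$ (the prime URs) is the following set of 24 URs: all formulas $\lambda\leftrightarrow\tau$ with $\lambda\in\{\lozenge e,\neg\lozenge e\}$ and $\tau\in\{1,\ e,\ e\vee\lozenge\neg e,\ e\vee\neg\lozenge\neg e,\ \neg e\vee\lozenge\neg e,\ \neg e\vee\neg\lozenge\neg e\}$, together with all formulas $\lambda\leftrightarrow\tau$ with $\lambda\in\{\lozenge\neg e,\neg\lozenge\neg e\}$ and $\tau\in\{1,\ e,\ e\vee\lozenge e,\ e\vee\neg\lozenge e,\ \neg e\vee\lozenge e,\ \neg e\vee\neg\lozenge e\}$ (so e.g. $\lozenge e\leftrightarrow 1$ is just $\lozenge e$). *)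

theory Defs
  imports "HOL-Algebra.Sym_Groups" "HOL-Algebra.Bij" "HOL-Algebra.Lattice"
begin

datatype fm =
    Var nat
  | Fls
  | Tru
  | Neg fm
  | Or fm fm
  | Dia fm

abbreviation And :: "fm \<Rightarrow> fm \<Rightarrow> fm"
  where "And p q \<equiv> Neg (Or (Neg p) (Neg q))"

abbreviation Imp :: "fm \<Rightarrow> fm \<Rightarrow> fm"
  where "Imp p q \<equiv> Or (Neg p) q"

abbreviation Iff :: "fm \<Rightarrow> fm \<Rightarrow> fm"
  where "Iff p q \<equiv> And (Imp p q) (Imp q p)"

primrec fvars :: "fm \<Rightarrow> nat set" where
  "fvars (Var i) = {i}"
| "fvars Fls = {}"
| "fvars Tru = {}"
| "fvars (Neg p) = fvars p"
| "fvars (Or p q) = fvars p \<union> fvars q"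
| "fvars (Dia p) = fvars p"

primrec mdegree :: "fm \<Rightarrow> nat" where
  "mdegree (Var i) = 0"
| "mdegree Fls = 0"
| "mdegree Tru = 0"
| "mdegree (Neg p) = mdegree p"
| "mdegree (Or p q) = max (mdegree p) (mdegree q)"
| "mdegree (Dia p) = Suc (mdegree p)"

primrec subst :: "(nat \<Rightarrow> fm) \<Rightarrow> fm \<Rightarrow> fm" where
  "subst s (Var i) = s i"
| "subst s Fls = Fls"
| "subst s Tru = Tru"
| "subst s (Neg p) = Neg (subst s p)"
| "subst s (Or p q) = Or (subst s p) (subst s q)"
| "subst s (Dia p) = Dia (subst s p)"

text \<open>
  Boolean evaluation. Formulas \<open>Dia p\<close> are treated as further atoms, with truth values
  given by \<open>d\<close>.
\<close>

primrec beval :: "(nat \<Rightarrow> bool) \<Rightarrow> (fm \<Rightarrow> bool) \<Rightarrow> fm \<Rightarrow> bool" where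
  "beval v d (Var i) \<longleftrightarrow> v i"
| "beval v d Fls \<longleftrightarrow> False"
| "beval v d Tru \<longleftrightarrow> True"
| "beval v d (Neg p) \<longleftrightarrow> \<not> beval v d p"
| "beval v d (Or p q) \<longleftrightarrow> beval v d p \<or> beval v d q"
| "beval v d (Dia p) \<longleftrightarrow> d p"

definition tautologies :: "fm set"
  where "tautologies = {p. \<forall>v d. beval v d p}"

inductive_set logic_closure :: "fm set \<Rightarrow> fm set" for X where
  base: "p \<in> X \<Longrightarrow> p \<in> logic_closure X"
| MP: "p \<in> logic_closure X \<Longrightarrow> Imp p q \<in> logic_closure X \<Longrightarrow> q \<in> logic_closure X"
| US: "p \<in> logic_closure X \<Longrightarrow> subst s p \<in> logic_closure X"
| RE: "Iff p q \<in> logic_closure X \<Longrightarrow> Iff (Dia p) (Dia q) \<in> logic_closure X"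

definition logic_E :: "fm set"
  where "logic_E = logic_closure tautologies"

definition CExtE :: "fm set set"
  where "CExtE = {S. logic_E \<subseteq> S
    \<and> (\<forall>p q. p \<in> S \<longrightarrow> Imp p q \<in> S \<longrightarrow> q \<in> S)
    \<and> (\<forall>p s. p \<in> S \<longrightarrow> subst s p \<in> S)
    \<and> (\<forall>p q. Iff p q \<in> S \<longrightarrow> Iff (Dia p) (Dia q) \<in> S)}"

definition CExtE_lattice :: "fm set gorder"
  where "CExtE_lattice = \<lparr>carrier = CExtE, eq = (=), le = (\<subseteq>)\<rparr>"

definition E_equiv :: "fm \<Rightarrow> fm \<Rightarrow> bool"  (infix \<open>\<approx>\<close> 50)
  where "p \<approx> q \<longleftrightarrow> Iff p q \<in> logic_E"

text \<open>The single variable of a uniform replacement is the variable with index 0.\<close>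

abbreviation e :: fm
  where "e \<equiv> Var 0"

definition UR :: "fm set"
  where "UR = {r. fvars r \<subseteq> {0} \<and> mdegree r \<le> 1}"

primrec replace :: "fm \<Rightarrow> fm \<Rightarrow> fm"  (infixl \<open>\<star>\<close> 70) where
  "Var i \<star> r = Var i"
| "Fls \<star> r = Fls"
| "Tru \<star> r = Tru"
| "Neg p \<star> r = Neg (p \<star> r)"
| "Or p q \<star> r = Or (p \<star> r) (q \<star> r)"
| "Dia p \<star> r = subst (Var(0 := p \<star> r)) r"

definition prime_forms :: "fm set"
  where "prime_forms =
    {Iff l t | l t. l \<in> {Dia e, Neg (Dia e)} \<and>
       t \<in> {Tru, e, Or e (Dia (Neg e)), Or e (Neg (Dia (Neg e))),
            Or (Neg e) (Dia (Neg e)), Or (Neg e) (Neg (Dia (Neg e)))}} \<union>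
    {Iff l t | l t. l \<in> {Dia (Neg e), Neg (Dia (Neg e))} \<and>
       t \<in> {Tru, e, Or e (Dia e), Or e (Neg (Dia e)),
            Or (Neg e) (Dia e), Or (Neg e) (Neg (Dia e))}}"

text \<open>
  Uniform replacements are considered up to \<open>\<approx>\<close>, so a prime one is any uniform
  replacement equivalent to one of the 24 displayed forms (for instance \<open>Dia e\<close>, which is
  equivalent to \<open>Iff (Dia e) Tru\<close>).
\<close>

definition prime_UR :: "fm set"
  where "prime_UR = {r \<in> UR. \<exists>r' \<in> prime_forms. r \<approx> r'}"

definition replace_logic :: "fm \<Rightarrow> fm set \<Rightarrow> fm set"
  where "replace_logic r S = {q. \<exists>p \<in> S. q \<approx> p \<star> r}"

definition replace_map :: "fm \<Rightarrow> fm set \<Rightarrow> fm set"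
  where "replace_map r = (\<lambda>S \<in> CExtE. replace_logic r S)"

definition lattice_auto :: "('a, 'b) gorder_scheme \<Rightarrow> ('a \<Rightarrow> 'a) set"
  where "lattice_auto L = {f \<in> Bij (carrier L). \<forall>x \<in> carrier L. \<forall>y \<in> carrier L.
    f (x \<sqinter>\<^bsub>L\<^esub> y) = f x \<sqinter>\<^bsub>L\<^esub> f y \<and> f (x \<squnion>\<^bsub>L\<^esub> y) = f x \<squnion>\<^bsub>L\<^esub> f y}"

definition prime_autos :: "(fm set \<Rightarrow> fm set) set"
  where "prime_autos = replace_map ` prime_UR"


lemma prime_forms_UR: "prime_forms \<subseteq> UR"
  unfolding prime_forms_def UR_def by auto

lemma card_prime_forms: "card prime_forms = 24"
proof -
  let ?f = "\<lambda>(l, t). Iff l t"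
  let ?A = "{Dia e, Neg (Dia e)} \<times>
    {Tru, e, Or e (Dia (Neg e)), Or e (Neg (Dia (Neg e))),
     Or (Neg e) (Dia (Neg e)), Or (Neg e) (Neg (Dia (Neg e)))}"
  let ?B = "{Dia (Neg e), Neg (Dia (Neg e))} \<times>
    {Tru, e, Or e (Dia e), Or e (Neg (Dia e)),
     Or (Neg e) (Dia e), Or (Neg e) (Neg (Dia e))}"
  have image: "{Iff l t | l t. l \<in> X \<and> t \<in> Y} = ?f ` (X \<times> Y)" for X Y
    by force
  have forms: "prime_forms = ?f ` (?A \<union> ?B)"
    unfolding prime_forms_def image image_Un by (rule refl)
  have inj: "inj_on ?f (?A \<union> ?B)"
  proof -
    have "inj ?f"
      by (rule injI) (simp add: case_prod_beta prod_eq_iff)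
    then show ?thesis
      by (rule inj_on_subset) (rule subset_UNIV)
  qed
  have card: "card (?A \<union> ?B) = 24"
  proof -
    have "?A \<inter> ?B = {}"
      by (simp add: Times_Int_Times)
    then have "card (?A \<union> ?B) = card ?A + card ?B"
      by (intro card_Un_disjoint) simp_all
    then show ?thesis
      by (simp add: card_cartesian_product)
  qed
  show ?thesis
    unfolding forms card_image[OF inj] by (rule card)
qed

lemma logic_closure_in_CExtE: "logic_E \<subseteq> X \<Longrightarrow> logic_closure X \<in> CExtE"
  unfolding CExtE_def mem_Collect_eq
  by (intro conjI allI impI)
    (blast intro: logic_closure.base, erule (1) logic_closure.MP,
      erule logic_closure.US, erule logic_closure.RE)

lemma logic_closure_least:
  assumes "S \<in> CExtE" "X \<subseteq> S"
  shows "logic_closure X \<subseteq> S"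
proof
  have MP: "p \<in> S \<Longrightarrow> Imp p q \<in> S \<Longrightarrow> q \<in> S"
    and US: "p \<in> S \<Longrightarrow> subst s p \<in> S"
    and RE: "Iff p q \<in> S \<Longrightarrow> Iff (Dia p) (Dia q) \<in> S" for p q s
    using assms(1) unfolding CExtE_def mem_Collect_eq by meson+
  fix p assume "p \<in> logic_closure X"
  then show "p \<in> S"
    by induction (use assms(2) in blast, erule (1) MP, erule US, erule RE)
qed

lemma logic_E_in_CExtE: "logic_E \<in> CExtE"
  unfolding CExtE_def logic_E_def mem_Collect_eq
  by (intro conjI allI impI)
    (rule subset_refl, erule (1) logic_closure.MP,
      erule logic_closure.US, erule logic_closure.RE)

lemma CExtE_imp_E_subset: "S \<in> CExtE \<Longrightarrow> logic_E \<subseteq> S"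
  unfolding CExtE_def mem_Collect_eq by (rule conjunct1)

lemma CExtE_Int: "S \<in> CExtE \<Longrightarrow> T \<in> CExtE \<Longrightarrow> S \<inter> T \<in> CExtE"
  unfolding CExtE_def mem_Collect_eq Int_iff by (simp only: le_inf_iff) meson

lemma CExtE_join_least:
  assumes "S \<in> CExtE" "T \<in> CExtE"
  shows "least CExtE_lattice (logic_closure (S \<union> T)) (Upper CExtE_lattice {S, T})"
proof -
  have "logic_closure (S \<union> T) \<in> CExtE"
    using CExtE_imp_E_subset[OF assms(1)] by (intro logic_closure_in_CExtE) (rule le_supI1)
  then show ?thesis
    using assms logic_closure_least[of _ "S \<union> T"]
    by (auto simp: least_def Upper_def CExtE_lattice_def intro: logic_closure.base)
qed

lemma CExtE_meet_greatest:
  assumes "S \<in> CExtE" "T \<in> CExtE"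
  shows "greatest CExtE_lattice (S \<inter> T) (Lower CExtE_lattice {S, T})"
  using assms CExtE_Int[OF assms]
  by (auto simp: greatest_def Lower_def CExtE_lattice_def)

lemma lattice_CExtE: "lattice CExtE_lattice"
proof -
  interpret partial_order CExtE_lattice
    by unfold_locales (auto simp: CExtE_lattice_def)
  show ?thesis
  proof unfold_locales
    fix S T
    assume "S \<in> carrier CExtE_lattice" "T \<in> carrier CExtE_lattice"
    then have *: "S \<in> CExtE" "T \<in> CExtE"
      by (simp_all add: CExtE_lattice_def)
    show "\<exists>U. least CExtE_lattice U (Upper CExtE_lattice {S, T})"
      using CExtE_join_least[OF *] by (rule exI)
    show "\<exists>U. greatest CExtE_lattice U (Lower CExtE_lattice {S, T})"
      using CExtE_meet_greatest[OF *] by (rule exI)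
  qed
qed

lemma CExtE_join:
  assumes "S \<in> CExtE" "T \<in> CExtE"
  shows "S \<squnion>\<^bsub>CExtE_lattice\<^esub> T = logic_closure (S \<union> T)"
proof -
  interpret lattice CExtE_lattice by (rule lattice_CExtE)
  show ?thesis
    unfolding join_def sup_def
    by (rule some_equality, rule CExtE_join_least[OF assms])
      (erule least_unique, rule CExtE_join_least[OF assms])
qed

lemma CExtE_meet:
  assumes "S \<in> CExtE" "T \<in> CExtE"
  shows "S \<sqinter>\<^bsub>CExtE_lattice\<^esub> T = S \<inter> T"
proof -
  interpret lattice CExtE_lattice by (rule lattice_CExtE)
  show ?thesis
    unfolding meet_def inf_def
    by (rule some_equality, rule CExtE_meet_greatest[OF assms])
      (erule greatest_unique, rule CExtE_meet_greatest[OF assms])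
qed

end

theory Submission
  imports Defs
begin

text \<open>
  A one-point neighbourhood frame is determined by the pair \<open>s\<close> of truth values of \<open>Dia Tru\<close> and
  \<open>Dia Fls\<close>. A uniform replacement \<open>r\<close> turns \<open>s\<close> into another pair \<open>point_action r s\<close>, and among
  the Boolean combinations of \<open>e\<close>, \<open>Dia e\<close>, \<open>Dia (Neg e)\<close> the resulting self-map of the four pairs
  determines \<open>r\<close> up to \<open>\<approx>\<close>. The 24 prime forms realise exactly the 24 permutations of the pairs, so
  every prime replacement \<open>r\<close> has a prime inverse \<open>r'\<close>. Hence the image of \<open>S\<close> under \<open>r\<close> is the
  preimage \<open>{q. q \<star> r' \<in> S}\<close>, which visibly is a logic, and the replacement maps are lattice
  automorphisms. They permute the logics of the four one-point frames; this action identifies them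
  with the symmetric group on four points.
\<close>

section \<open>Derived rules of classical modal logics\<close>

lemma CExtE_intro:
  assumes "\<And>p. p \<in> tautologies \<Longrightarrow> p \<in> S"
    and "\<And>p q. p \<in> S \<Longrightarrow> Imp p q \<in> S \<Longrightarrow> q \<in> S"
    and "\<And>p s. p \<in> S \<Longrightarrow> subst s p \<in> S"
    and "\<And>p q. Iff p q \<in> S \<Longrightarrow> Iff (Dia p) (Dia q) \<in> S"
  shows "S \<in> CExtE"
proof -
  have "p \<in> S" if "p \<in> logic_closure tautologies" for p
    using that
    by induction (erule assms(1), erule (1) assms(2), erule assms(3), erule assms(4))
  then show ?thesis
    unfolding CExtE_def logic_E_def using assms(2-) by (intro CollectI conjI allI impI subsetI)
qed

lemma
  assumes "S \<in> CExtE"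
  shows CExtE_MP: "p \<in> S \<Longrightarrow> Imp p q \<in> S \<Longrightarrow> q \<in> S"
    and CExtE_US: "p \<in> S \<Longrightarrow> subst s p \<in> S"
    and CExtE_RE: "Iff p q \<in> S \<Longrightarrow> Iff (Dia p) (Dia q) \<in> S"
  using assms unfolding CExtE_def mem_Collect_eq by meson+

lemma CExtE_taut:
  assumes "S \<in> CExtE" "\<And>v d. beval v d p"
  shows "p \<in> S"
proof -
  have "p \<in> logic_E"
    unfolding logic_E_def by (rule logic_closure.base) (simp add: tautologies_def assms(2))
  then show ?thesis
    using CExtE_imp_E_subset[OF assms(1)] by (rule rev_subsetD)
qed

lemma CExtE_conseq:
  assumes "S \<in> CExtE" "p \<in> S" "\<And>v d. beval v d p \<Longrightarrow> beval v d q"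
  shows "q \<in> S"
  by (rule CExtE_MP[OF assms(1,2)], rule CExtE_taut[OF assms(1)]) (use assms(3) in auto)

lemma CExtE_conseq2:
  assumes "S \<in> CExtE" "p \<in> S" "q \<in> S" "\<And>v d. beval v d p \<Longrightarrow> beval v d q \<Longrightarrow> beval v d r"
  shows "r \<in> S"
  by (rule CExtE_MP[OF assms(1,3)], rule CExtE_conseq[OF assms(1,2)]) (use assms(4) in auto)

lemma Iff_refl: "S \<in> CExtE \<Longrightarrow> Iff p p \<in> S"
  by (erule CExtE_taut) simp

lemma Iff_sym:
  assumes "S \<in> CExtE" "Iff p q \<in> S"
  shows "Iff q p \<in> S"
  by (rule CExtE_conseq[OF assms]) (unfold beval.simps, blast)

lemma Iff_trans:
  assumes "S \<in> CExtE" "Iff p q \<in> S" "Iff q r \<in> S"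
  shows "Iff p r \<in> S"
  by (rule CExtE_conseq2[OF assms]) (unfold beval.simps, blast)

lemma Iff_mem:
  assumes "S \<in> CExtE" "Iff p q \<in> S" "p \<in> S"
  shows "q \<in> S"
  by (rule CExtE_conseq2[OF assms]) (unfold beval.simps, blast)

lemma Iff_Neg:
  assumes "S \<in> CExtE" "Iff p q \<in> S"
  shows "Iff (Neg p) (Neg q) \<in> S"
  by (rule CExtE_conseq[OF assms]) (unfold beval.simps, blast)

lemma Iff_Or:
  assumes "S \<in> CExtE" "Iff p q \<in> S" "Iff p' q' \<in> S"
  shows "Iff (Or p p') (Or q q') \<in> S"
  by (rule CExtE_conseq2[OF assms]) (unfold beval.simps, blast)

lemma Iff_subst:
  assumes "S \<in> CExtE" "\<And>i. Iff (s i) (t i) \<in> S"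
  shows "Iff (subst s p) (subst t p) \<in> S"
  by (induction p)
    (simp_all only: subst.simps assms Iff_refl Iff_Neg Iff_Or CExtE_RE)

lemma E_equiv_refl: "p \<approx> p"
  and E_equiv_sym: "p \<approx> q \<Longrightarrow> q \<approx> p"
  and E_equiv_trans: "p \<approx> q \<Longrightarrow> q \<approx> r \<Longrightarrow> p \<approx> r"
  and E_equiv_Neg: "p \<approx> q \<Longrightarrow> Neg p \<approx> Neg q"
  and E_equiv_Or: "p \<approx> q \<Longrightarrow> p' \<approx> q' \<Longrightarrow> Or p p' \<approx> Or q q'"
  and E_equiv_Dia: "p \<approx> q \<Longrightarrow> Dia p \<approx> Dia q"
  and E_equiv_subst: "p \<approx> q \<Longrightarrow> subst s p \<approx> subst s q"
  unfolding E_equiv_def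
  by (rule Iff_refl[OF logic_E_in_CExtE], erule Iff_sym[OF logic_E_in_CExtE],
      erule (1) Iff_trans[OF logic_E_in_CExtE], erule Iff_Neg[OF logic_E_in_CExtE],
      erule (1) Iff_Or[OF logic_E_in_CExtE], erule CExtE_RE[OF logic_E_in_CExtE],
      drule CExtE_US[OF logic_E_in_CExtE], simp)

lemma E_equiv_mem: "S \<in> CExtE \<Longrightarrow> p \<approx> q \<Longrightarrow> p \<in> S \<longleftrightarrow> q \<in> S"
  unfolding E_equiv_def
  using CExtE_imp_E_subset[of S] Iff_mem[of S p q] Iff_mem[of S q p] Iff_sym[of S p q] by blast

lemma subst_subst: "subst s (subst t p) = subst (\<lambda>i. subst s (t i)) p"
  by (induction p) auto

lemma subst_fvars_cong: "(\<And>i. i \<in> fvars p \<Longrightarrow> s i = t i) \<Longrightarrow> subst s p = subst t p"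
  by (induction p) auto

lemma subst_Var: "subst Var p = p"
  by (induction p) auto

text \<open>In the \<open>Dia\<close> case both sides substitute into \<open>r\<close>. Since
  \<open>e\<close> is the only variable of \<open>r\<close>, the outer substitution reaches only the
  copies of \<open>p \<star> r\<close>, where the induction hypothesis applies.\<close>

lemma replace_subst:
  assumes "fvars r \<subseteq> {0}"
  shows "subst s p \<star> r = subst (\<lambda>i. s i \<star> r) (p \<star> r)"
proof (induction p)
  case (Dia p)
  then show ?case
    unfolding replace.simps subst.simps subst_subst
    by (intro subst_fvars_cong) (use assms in auto)
qed auto

text \<open>In the \<open>Dia\<close> case \<open>replace_subst\<close> pushes \<open>r'\<close>
  through the substitution into \<open>r\<close>. This makes \<open>r \<star> r'\<close> the product
  of two replacements.\<close>

lemma replace_replace: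
  assumes "fvars r' \<subseteq> {0}"
  shows "(p \<star> r) \<star> r' = p \<star> (r \<star> r')"
proof (induction p)
  case (Dia p)
  then show ?case
    unfolding replace.simps replace_subst[OF assms]
    by (intro subst_fvars_cong) auto
qed auto

lemma replace_Dia_e: "p \<star> Dia e = p"
  by (induction p) auto

lemma Iff_replace:
  assumes "S \<in> CExtE" "Iff p q \<in> S"
  shows "Iff (subst (Var(0 := p)) r) (subst (Var(0 := q)) r) \<in> S"
  by (rule Iff_subst) (use assms Iff_refl in auto)

lemma E_equiv_replace:
  assumes "r \<approx> r'"
  shows "p \<star> r \<approx> p \<star> r'"
proof (induction p)
  case (Dia p)
  have "subst (Var(0 := p \<star> r)) r \<approx> subst (Var(0 := p \<star> r)) r'"
    by (rule E_equiv_subst[OF assms])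
  moreover have "subst (Var(0 := p \<star> r)) r' \<approx> subst (Var(0 := p \<star> r')) r'"
    using Iff_replace[OF logic_E_in_CExtE Dia[unfolded E_equiv_def]] unfolding E_equiv_def .
  ultimately show ?case
    unfolding replace.simps by (rule E_equiv_trans)
qed (simp_all only: replace.simps E_equiv_refl E_equiv_Neg E_equiv_Or)

text \<open>MP pulls back literally, US by \<open>replace_subst\<close>, and RE because equivalents
  may be exchanged inside \<open>r\<close>.\<close>

lemma replace_preimage_CExtE:
  assumes "fvars r \<subseteq> {0}" "S \<in> CExtE"
  shows "{p. p \<star> r \<in> S} \<in> CExtE"
proof (rule CExtE_intro; simp only: mem_Collect_eq replace.simps)
  fix p assume "p \<in> tautologies"
  \<comment> \<open>The modal atoms are reinterpreted: \<open>Dia q\<close> receives the value of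
    \<open>Dia q \<star> r\<close>. A tautology survives any such choice.\<close>
  have "beval v d (p \<star> r) = beval v (\<lambda>q. beval v d (Dia q \<star> r)) p" for v d
    by (induction p) auto
  with \<open>p \<in> tautologies\<close> show "p \<star> r \<in> S"
    by (intro CExtE_taut[OF assms(2)]) (simp add: tautologies_def)
next
  show "q \<star> r \<in> S" if "p \<star> r \<in> S" "Imp (p \<star> r) (q \<star> r) \<in> S" for p q
    using CExtE_MP[OF assms(2) that] .
next
  show "subst s p \<star> r \<in> S" if "p \<star> r \<in> S" for p s
    unfolding replace_subst[OF assms(1)] by (rule CExtE_US[OF assms(2) that])
qed (rule Iff_replace[OF assms(2)])

text \<open>The preimage of \<open>logic_E\<close> under replacement is a classical modal logic,
  hence contains the least one.\<close>

lemma replace_E_equiv: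
  assumes "fvars r \<subseteq> {0}" "p \<approx> q"
  shows "p \<star> r \<approx> q \<star> r"
proof -
  have "Iff p q \<in> {p. p \<star> r \<in> logic_E}"
    using CExtE_imp_E_subset[OF replace_preimage_CExtE[OF assms(1) logic_E_in_CExtE]]
      assms(2)[unfolded E_equiv_def] by (rule subsetD)
  then show ?thesis
    by (simp add: E_equiv_def)
qed

text \<open>Reduces questions about \<open>prime_UR\<close> to the displayed forms.\<close>

lemma replace_logic_cong:
  assumes "r \<approx> r'"
  shows "replace_logic r = replace_logic r'"
proof -
  have "q \<approx> p \<star> r \<longleftrightarrow> q \<approx> p \<star> r'" for p q
    using E_equiv_trans[of q] E_equiv_replace[OF assms, of p] E_equiv_sym by blast
  then show ?thesis
    unfolding replace_logic_def by simp
qed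

section \<open>One-point neighbourhood frames\<close>

text \<open>Truth in the one-point neighbourhood frame in which \<open>Dia\<close> sends the full set to
  \<open>fst s\<close> and the empty set to \<open>snd s\<close>.\<close>

primrec point_eval :: "bool \<times> bool \<Rightarrow> (nat \<Rightarrow> bool) \<Rightarrow> fm \<Rightarrow> bool" where
  "point_eval s v (Var i) \<longleftrightarrow> v i"
| "point_eval s v Fls \<longleftrightarrow> False"
| "point_eval s v Tru \<longleftrightarrow> True"
| "point_eval s v (Neg p) \<longleftrightarrow> \<not> point_eval s v p"
| "point_eval s v (Or p q) \<longleftrightarrow> point_eval s v p \<or> point_eval s v q"
| "point_eval s v (Dia p) \<longleftrightarrow> (if point_eval s v p then fst s else snd s)"

definition point_logic :: "bool \<times> bool \<Rightarrow> fm set"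
  where "point_logic s = {p. \<forall>v. point_eval s v p}"

text \<open>The pair collects the values of \<open>r\<close> on the full and the empty set, so for
  \<open>r\<close> in the variable \<open>e\<close> it is the frame in which \<open>Dia\<close> is
  read as \<open>r\<close>.\<close>

definition point_action :: "fm \<Rightarrow> bool \<times> bool \<Rightarrow> bool \<times> bool"
  where "point_action r s = (point_eval s (\<lambda>_. True) r, point_eval s (\<lambda>_. False) r)"

lemma point_eval_beval: "point_eval s v p = beval v (\<lambda>q. point_eval s v (Dia q)) p"
  by (induction p) auto

lemma point_eval_subst: "point_eval s v (subst t p) = point_eval s (\<lambda>i. point_eval s v (t i)) p"
  by (induction p) auto

lemma point_logic_CExtE: "point_logic s \<in> CExtE"
proof (rule CExtE_intro)
  show "p \<in> point_logic s" if "p \<in> tautologies" for p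
    using that point_eval_beval unfolding tautologies_def point_logic_def by blast
qed (auto simp: point_logic_def point_eval_subst)

lemma point_logic_inj: "point_logic s = point_logic t \<longleftrightarrow> s = t"
proof -
  \<comment> \<open>Two constant formulas read off the components of the pair.\<close>
  have "Dia Tru \<in> point_logic s \<longleftrightarrow> fst s" "Dia Fls \<in> point_logic s \<longleftrightarrow> snd s" for s
    by (simp_all add: point_logic_def)
  then show ?thesis
    by (intro iffI prod_eqI) blast+
qed

lemma E_equiv_point_eval: "p \<approx> q \<Longrightarrow> point_eval s v p = point_eval s v q"
  using CExtE_imp_E_subset[OF point_logic_CExtE[of s]]
  by (auto simp: E_equiv_def point_logic_def)

lemma point_eval_fvars_cong:
  "(\<And>i. i \<in> fvars p \<Longrightarrow> v i = w i) \<Longrightarrow> point_eval s v p = point_eval s w p"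
  by (induction p) auto

text \<open>On one point a proposition is full or empty, so the value of
  \<open>Dia p \<star> r\<close> depends only on the truth value of \<open>p \<star> r\<close>, and
  \<open>point_action\<close> tabulates both cases.\<close>

lemma point_eval_replace:
  assumes "fvars r \<subseteq> {0}"
  shows "point_eval s v (p \<star> r) = point_eval (point_action r s) v p"
proof (induction p)
  case (Dia p)
  have "point_eval s v (Dia p \<star> r) = point_eval s (\<lambda>_. point_eval s v (p \<star> r)) r"
    unfolding replace.simps point_eval_subst
    by (rule point_eval_fvars_cong) (use assms in auto)
  then show ?case
    using Dia by (auto simp: point_action_def)
qed auto

lemma point_logic_replace:
  assumes "fvars r \<subseteq> {0}"
  shows "p \<star> r \<in> point_logic s \<longleftrightarrow> p \<in> point_logic (point_action r s)"
  by (simp add: point_logic_def point_eval_replace[OF assms])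

section \<open>The Boolean span of the prime forms\<close>

text \<open>The span contains the displayed forms and is closed under replacement up to
  \<open>\<approx>\<close>. \<open>Dia Tru\<close> and \<open>Dia Fls\<close> are left out: on one
  point \<open>Dia Tru\<close> agrees with
  \<open>Or (And e (Dia e)) (And (Neg e) (Dia (Neg e)))\<close>, but in \<open>logic_E\<close> it
  does not.\<close>

inductive prime_span :: "fm \<Rightarrow> bool" where
  "prime_span e"
| "prime_span Tru"
| "prime_span Fls"
| "prime_span (Dia e)"
| "prime_span (Dia (Neg e))"
| "prime_span p \<Longrightarrow> prime_span (Neg p)"
| "prime_span p \<Longrightarrow> prime_span q \<Longrightarrow> prime_span (Or p q)"

lemma prime_span_forms: "r \<in> prime_forms \<Longrightarrow> prime_span r"
  unfolding prime_forms_def by (auto intro!: prime_span.intros)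

text \<open>Any truth values of \<open>e\<close>, \<open>Dia e\<close> and \<open>Dia (Neg e)\<close> are realised in a one-point frame, so
  these frames decide equivalence on the span.\<close>

lemma prime_span_beval:
  assumes "prime_span p"
  shows "beval v d p = point_eval (if v 0 then (d e, d (Neg e)) else (d (Neg e), d e)) (\<lambda>_. v 0) p"
  using assms by induction auto

text \<open>A Boolean valuation of a span formula amounts to a one-point evaluation under a constant
  valuation, which is what \<open>point_action\<close> records; so the biconditional is a
  tautology.\<close>

lemma prime_span_equiv:
  assumes "prime_span p" "prime_span q" "point_action p = point_action q"
  shows "p \<approx> q"
proof -
  have "point_eval s (\<lambda>_. b) p = point_eval s (\<lambda>_. b) q" for s b
    using fun_cong[OF assms(3), of s] by (cases b) (simp_all add: point_action_def)
  then show ?thesis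
    unfolding E_equiv_def
    by (intro CExtE_taut[OF logic_E_in_CExtE])
      (simp add: prime_span_beval[OF assms(1)] prime_span_beval[OF assms(2)])
qed

text \<open>The substitution interchanges the two modal atoms up to a double negation under
  \<open>Dia\<close>, which RE removes.\<close>

lemma prime_span_subst_Neg:
  assumes "prime_span r"
  shows "\<exists>t. prime_span t \<and> subst (Var(0 := Neg e)) r \<approx> t"
  using assms
proof induction
  case 5
  have "Neg (Neg e) \<approx> e"
    unfolding E_equiv_def by (rule CExtE_taut[OF logic_E_in_CExtE]) auto
  from E_equiv_Dia[OF this] show ?case
    using prime_span.intros(4) by auto
next
  case (6 p)
  then obtain t where t: "prime_span t" "subst (Var(0 := Neg e)) p \<approx> t"
    by blast
  show ?case
    unfolding subst.simps
    by (intro exI conjI) (rule prime_span.intros(6)[OF t(1)], rule E_equiv_Neg[OF t(2)])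
next
  case (7 p q)
  then obtain t u where t: "prime_span t" "subst (Var(0 := Neg e)) p \<approx> t" and u: "prime_span u" "subst (Var(0 := Neg e)) q \<approx> u"
    by blast
  show ?case
    unfolding subst.simps
    by (intro exI conjI) (rule prime_span.intros(7)[OF t(1) u(1)], rule E_equiv_Or[OF t(2) u(2)])
qed (auto intro: prime_span.intros E_equiv_refl)

text \<open>Only the modal atoms matter: \<open>Dia e\<close> turns into \<open>r\<close>, and
  \<open>Dia (Neg e)\<close> into \<open>r\<close> with \<open>Neg e\<close> for
  \<open>e\<close>.\<close>

lemma prime_span_replace:
  assumes "prime_span p" "prime_span r"
  shows "\<exists>t. prime_span t \<and> p \<star> r \<approx> t"
  using assms(1)
proof induction
  case 4
  then show ?case
    using assms(2) E_equiv_refl by (auto simp: subst_Var)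
next
  case 5
  then show ?case
    using prime_span_subst_Neg[OF assms(2)] by simp
next
  case (6 p)
  then obtain t where t: "prime_span t" "p \<star> r \<approx> t"
    by blast
  show ?case
    unfolding replace.simps
    by (intro exI conjI) (rule prime_span.intros(6)[OF t(1)], rule E_equiv_Neg[OF t(2)])
next
  case (7 p q)
  then obtain t u where t: "prime_span t" "p \<star> r \<approx> t" and u: "prime_span u" "q \<star> r \<approx> u"
    by blast
  show ?case
    unfolding replace.simps
    by (intro exI conjI) (rule prime_span.intros(7)[OF t(1) u(1)], rule E_equiv_Or[OF t(2) u(2)])
qed (auto intro: prime_span.intros E_equiv_refl)

section \<open>The 24 prime forms as permutations of four pairs\<close>

lemma prime_forms_fvars: "r \<in> prime_forms \<Longrightarrow> fvars r \<subseteq> {0}"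
  using prime_forms_UR by (auto simp: UR_def)

definition prime_form_list :: "fm list"
  where "prime_form_list = map (\<lambda>(l, t). Iff l t)
    (List.product [Dia e, Neg (Dia e)]
       [Tru, e, Or e (Dia (Neg e)), Or e (Neg (Dia (Neg e))),
        Or (Neg e) (Dia (Neg e)), Or (Neg e) (Neg (Dia (Neg e)))] @
     List.product [Dia (Neg e), Neg (Dia (Neg e))]
       [Tru, e, Or e (Dia e), Or e (Neg (Dia e)), Or (Neg e) (Dia e), Or (Neg e) (Neg (Dia e))])"

lemma set_prime_form_list: "set prime_form_list = prime_forms"
proof -
  have image: "{Iff l t | l t. l \<in> X \<and> t \<in> Y} = (\<lambda>(l, t). Iff l t) ` (X \<times> Y)" for X Y
    by force
  show ?thesis
    unfolding prime_forms_def prime_form_list_def image set_map set_append set_product image_Un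
    by (simp only: list.set)
qed

text \<open>As a list of values, an action is accessible to evaluation: injectivity of one action
  and distinctness of all 24 become instances of \<open>distinct\<close>.\<close>

definition action_table :: "fm \<Rightarrow> (bool \<times> bool) list"
  where "action_table r =
    map (point_action r) [(True, True), (True, False), (False, True), (False, False)]"

lemma point_action_bij:
  assumes "r \<in> prime_forms"
  shows "bij (point_action r)"
proof -
  have "list_all (\<lambda>r. distinct (action_table r)) prime_form_list"
    by code_simp
  then have "distinct (action_table r)"
    using assms by (simp add: list_all_iff set_prime_form_list)
  then have "inj (point_action r)"
    by (auto simp: action_table_def inj_def all_bool_eq)
  then show ?thesis
    using finite_UNIV_inj_surj[OF finite] by (simp add: bij_def)
qed

lemma point_action_inj: "inj_on point_action prime_forms"
proof -
  have "distinct (map action_table prime_form_list)"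
    by code_simp
  then have "inj_on action_table prime_forms"
    by (simp add: distinct_map set_prime_form_list)
  then show ?thesis
    by (auto simp: inj_on_def action_table_def)
qed

lemma bij_eq_permutes: "{\<pi>. bij \<pi>} = {\<pi>. \<pi> permutes UNIV}"
  by (simp add: permutes_univ bij_iff)

text \<open>By counting: 24 forms with distinct bijective actions exhaust the 4!
  permutations.\<close>

lemma point_action_image: "point_action ` prime_forms = {\<pi>. bij \<pi>}"
proof (rule card_subset_eq)
  have "card {\<pi> :: bool \<times> bool \<Rightarrow> bool \<times> bool. \<pi> permutes UNIV} = fact 4"
    by (rule card_permutations) (simp_all flip: UNIV_Times_UNIV)
  then show "card (point_action ` prime_forms) = card {\<pi> :: bool \<times> bool \<Rightarrow> bool \<times> bool. bij \<pi>}"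
    unfolding bij_eq_permutes card_image[OF point_action_inj] card_prime_forms by (simp add: fact_numeral)
qed (auto simp: point_action_bij)

text \<open>\<open>q \<star> r\<close> itself need not lie in the span, so a span representative
  \<open>u\<close> is taken. Its action is the composite, hence that of \<open>t\<close>, and
  actions decide equivalence on the span.\<close>

lemma replace_equiv_of_action:
  assumes "q \<in> prime_forms" "r \<in> prime_forms" "prime_span t"
    and "point_action t = point_action q \<circ> point_action r"
  shows "q \<star> r \<approx> t"
proof -
  obtain u where u: "prime_span u" "q \<star> r \<approx> u"
    using prime_span_replace assms prime_span_forms by blast
  have "point_action u s = point_action t s" for s
  proof -
    have "point_action u s = point_action (q \<star> r) s"
      by (simp add: point_action_def E_equiv_point_eval[OF u(2)])
    also have "\<dots> = point_action q (point_action r s)"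
      by (simp add: point_action_def[of _ s] point_action_def[of q]
          point_eval_replace[OF prime_forms_fvars[OF assms(2)]])
    finally show ?thesis
      by (simp add: assms(4))
  qed
  then have "u \<approx> t"
    by (intro prime_span_equiv u assms ext)
  then show ?thesis
    using E_equiv_trans u(2) by blast
qed

section \<open>Inverse replacements and lattice automorphisms\<close>

definition prime_inverse :: "fm \<Rightarrow> fm \<Rightarrow> bool" where
  "prime_inverse r r' \<longleftrightarrow> r \<in> prime_forms \<and> r' \<in> prime_forms \<and> point_action r' = inv_into UNIV (point_action r)"

lemma ex_prime_inverse:
  assumes "r \<in> prime_forms"
  shows "\<exists>r'. prime_inverse r r'"
proof -
  have "inv_into UNIV (point_action r) \<in> point_action ` prime_forms"
    using point_action_bij[OF assms] by (simp add: point_action_image bij_imp_bij_inv)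
  then show ?thesis
    unfolding prime_inverse_def using assms by auto
qed

lemma prime_inverse_sym: "prime_inverse r r' \<Longrightarrow> prime_inverse r' r"
  by (simp add: prime_inverse_def inv_inv_eq point_action_bij)

text \<open>The product \<open>r \<star> r'\<close> has the identity action, so it is equivalent to
  \<open>Dia e\<close>, the identity replacement.\<close>

lemma prime_inverse_replace:
  assumes "prime_inverse r r'"
  shows "(p \<star> r) \<star> r' \<approx> p"
proof -
  have r: "r \<in> prime_forms" "r' \<in> prime_forms" "point_action r' = inv_into UNIV (point_action r)"
    using assms by (auto simp: prime_inverse_def)
  have "point_action (Dia e) = id"
    by (auto simp: point_action_def)
  also have "\<dots> = point_action r \<circ> point_action r'"
    using point_action_bij[OF r(1)] by (simp add: r(3) bij_is_surj surj_iff[THEN iffD1])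
  finally have "r \<star> r' \<approx> Dia e"
    using r by (auto intro: replace_equiv_of_action prime_span.intros)
  from E_equiv_replace[OF this] show ?thesis
    by (simp add: replace_replace[OF prime_forms_fvars[OF r(2)]] replace_Dia_e)
qed

lemma replace_logic_eq:
  assumes "prime_inverse r r'" "S \<in> CExtE"
  shows "replace_logic r S = {q. q \<star> r' \<in> S}"
proof -
  have r': "fvars r' \<subseteq> {0}"
    using assms(1) prime_forms_fvars by (simp add: prime_inverse_def)
  \<comment> \<open>Applying \<open>r'\<close> to \<open>q \<approx> p \<star> r\<close> gives back
    \<open>p\<close> up to \<open>\<approx>\<close>.\<close>
  have "q \<star> r' \<in> S" if "p \<in> S" "q \<approx> p \<star> r" for p q
    using replace_E_equiv[OF r' that(2)] E_equiv_mem[OF assms(2)]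
      prime_inverse_replace[OF assms(1)] that(1) by blast
  \<comment> \<open>Conversely, \<open>q \<star> r'\<close> serves as the member of \<open>S\<close>
    whose image is \<open>q\<close>.\<close>
  moreover have "q \<approx> (q \<star> r') \<star> r" for q
    using prime_inverse_replace[OF prime_inverse_sym[OF assms(1)]] E_equiv_sym by blast
  ultimately show ?thesis
    unfolding replace_logic_def by blast
qed

lemma replace_logic_CExtE:
  assumes "prime_inverse r r'" "S \<in> CExtE"
  shows "replace_logic r S \<in> CExtE"
  unfolding replace_logic_eq[OF assms]
  using assms prime_forms_fvars by (auto simp: prime_inverse_def intro: replace_preimage_CExtE)

lemma replace_logic_inverse:
  assumes "prime_inverse r r'" "S \<in> CExtE"
  shows "replace_logic r (replace_logic r' S) = S"
proof -
  note inv' = prime_inverse_sym[OF assms(1)]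
  show ?thesis
    by (subst replace_logic_eq[OF assms(1) replace_logic_CExtE[OF inv' assms(2)]])
      (simp add: replace_logic_eq[OF inv' assms(2)]
        E_equiv_mem[OF assms(2) prime_inverse_replace[OF inv']])
qed

text \<open>Membership in the image is tested by replacing with \<open>r'\<close>, hence the inverse
  action.\<close>

lemma replace_logic_point_logic:
  assumes "prime_inverse r r'"
  shows "replace_logic r (point_logic s) = point_logic (point_action r' s)"
  unfolding replace_logic_eq[OF assms point_logic_CExtE]
  using assms prime_forms_fvars by (simp add: prime_inverse_def point_logic_replace)

lemma carrier_CExtE_lattice: "carrier CExtE_lattice = CExtE"
  by (simp add: CExtE_lattice_def)

text \<open>Meets are intersections and commute with preimages. Joins are preserved because the map
  and its inverse are both monotone.\<close>

lemma replace_map_lattice_auto: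
  assumes "prime_inverse r r'"
  shows "replace_map r \<in> lattice_auto CExtE_lattice"
proof -
  let ?f = "replace_logic r" and ?g = "replace_logic r'"
  note inv' = prime_inverse_sym[OF assms]
  note CExtE_f = replace_logic_CExtE[OF assms] and CExtE_g = replace_logic_CExtE[OF inv']
  note fg = replace_logic_inverse[OF assms] and gf = replace_logic_inverse[OF inv']
  have mono: "replace_logic q S \<subseteq> replace_logic q T" if "S \<subseteq> T" for q S T
    using that unfolding replace_logic_def by blast
  have "bij_betw ?f CExtE CExtE"
    by (rule bij_betw_byWitness[where f' = ?g]) (auto simp: CExtE_f CExtE_g fg gf)
  then have "replace_map r \<in> Bij CExtE"
    unfolding Bij_def replace_map_def by (auto simp: bij_betw_restrict_eq)
  moreover have "replace_map r (S \<inter> T) = replace_map r S \<inter> replace_map r T"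
    if "S \<in> CExtE" "T \<in> CExtE" for S T
    using that by (auto simp: replace_map_def CExtE_Int replace_logic_eq[OF assms])
  moreover have "replace_map r (logic_closure (S \<union> T))
      = logic_closure (replace_map r S \<union> replace_map r T)"
    if S: "S \<in> CExtE" and T: "T \<in> CExtE" for S T
  proof -
    have J: "logic_closure (S \<union> T) \<in> CExtE" "logic_closure (?f S \<union> ?f T) \<in> CExtE"
      using CExtE_imp_E_subset[OF S] CExtE_imp_E_subset[OF CExtE_f[OF S]]
      by (auto intro: logic_closure_in_CExtE)
    have "logic_closure (?f S \<union> ?f T) \<subseteq> ?f (logic_closure (S \<union> T))"
      by (intro logic_closure_least CExtE_f J Un_least mono) (auto intro: logic_closure.base)
    \<comment> \<open>For the other inclusion: \<open>?g\<close> undoes \<open>?f\<close>, so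
      \<open>S\<close> and \<open>T\<close> lie in the \<open>?g\<close>-image of the join of the
      images; then \<open>?f\<close> is applied.\<close>
    moreover have "?g (?f S) \<subseteq> ?g (logic_closure (?f S \<union> ?f T))"
      and "?g (?f T) \<subseteq> ?g (logic_closure (?f S \<union> ?f T))"
      by (rule mono; auto intro: logic_closure.base)+
    then have "logic_closure (S \<union> T) \<subseteq> ?g (logic_closure (?f S \<union> ?f T))"
      by (intro logic_closure_least CExtE_g J) (simp add: gf S T)
    from mono[OF this, of r] have "?f (logic_closure (S \<union> T)) \<subseteq> logic_closure (?f S \<union> ?f T)"
      by (simp add: fg J)
    ultimately show ?thesis
      using S T J by (auto simp: replace_map_def)
  qed
  moreover have "replace_map r S \<in> CExtE" if "S \<in> CExtE" for S
    using that CExtE_f by (simp add: replace_map_def)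
  ultimately show ?thesis
    by (simp add: lattice_auto_def carrier_CExtE_lattice CExtE_meet CExtE_join)
qed

section \<open>The group of prime automorphisms\<close>

lemma prime_UR_form:
  assumes "r \<in> prime_UR"
  obtains r' where "r' \<in> prime_forms" "replace_logic r = replace_logic r'"
    "replace_map r = replace_map r'"
  using assms replace_logic_cong unfolding prime_UR_def replace_map_def by fastforce

lemma prime_autos_eq: "prime_autos = replace_map ` prime_forms"
proof -
  have "prime_forms \<subseteq> prime_UR"
    using prime_forms_UR E_equiv_refl by (auto simp: prime_UR_def)
  then show ?thesis
    unfolding prime_autos_def by (auto elim!: prime_UR_form)
qed

lemma prime_autosE:
  assumes "f \<in> prime_autos"
  obtains r r' where "f = replace_map r" "prime_inverse r r'"
  using assms ex_prime_inverse unfolding prime_autos_eq by blast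

lemma prime_autos_lattice_auto: "prime_autos \<subseteq> lattice_auto CExtE_lattice"
  using ex_prime_inverse replace_map_lattice_auto unfolding prime_autos_eq by blast

lemma prime_autos_Bij: "prime_autos \<subseteq> Bij CExtE"
  using prime_autos_lattice_auto by (auto simp: lattice_auto_def carrier_CExtE_lattice)

lemma replace_map_compose:
  assumes "q \<in> prime_forms" "r \<in> prime_forms"
  shows "compose CExtE (replace_map q) (replace_map r) \<in> prime_autos"
proof -
  obtain q' r' where q': "prime_inverse q q'" and r': "prime_inverse r r'"
    using ex_prime_inverse assms by blast
  then have prime: "q' \<in> prime_forms" "r' \<in> prime_forms"
    by (simp_all add: prime_inverse_def)
  \<comment> \<open>Preimages compose by replacing with \<open>q'\<close>, then with
    \<open>r'\<close>. The product acts as a permutation, so some form \<open>t'\<close> realises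
    it; the sought replacement is the inverse \<open>t\<close> of \<open>t'\<close>.\<close>
  have "bij (point_action q' \<circ> point_action r')"
    using prime point_action_bij by (blast intro: bij_comp)
  then have "point_action q' \<circ> point_action r' \<in> point_action ` prime_forms"
    by (simp add: point_action_image)
  then obtain t' where "t' \<in> prime_forms" "point_action t' = point_action q' \<circ> point_action r'"
    by auto
  then have t': "q' \<star> r' \<approx> t'"
    using prime by (intro replace_equiv_of_action prime_span_forms)
  obtain t where t: "prime_inverse t t'"
    using ex_prime_inverse[OF \<open>t' \<in> prime_forms\<close>] prime_inverse_sym by blast
  have "replace_logic q (replace_logic r S) = replace_logic t S" if "S \<in> CExtE" for S
  proof -
    have "(p \<star> q') \<star> r' \<in> S \<longleftrightarrow> p \<star> t' \<in> S" for p
      unfolding replace_replace[OF prime_forms_fvars[OF prime(2)]]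
      by (rule E_equiv_mem[OF that E_equiv_replace[OF t']])
    then show ?thesis
      by (subst replace_logic_eq[OF q' replace_logic_CExtE[OF r' that]])
        (simp add: replace_logic_eq[OF r' that] replace_logic_eq[OF t that])
  qed
  then have "compose CExtE (replace_map q) (replace_map r) = replace_map t"
    using replace_logic_CExtE[OF r'] by (simp add: compose_def replace_map_def cong: restrict_cong)
  then show ?thesis
    using t by (auto simp: prime_autos_eq prime_inverse_def)
qed

lemma prime_autos_subgroup: "subgroup prime_autos (BijGroup CExtE)"
proof (rule group.subgroupI[OF group_BijGroup])
  show "prime_autos \<subseteq> carrier (BijGroup CExtE)"
    using prime_autos_Bij by (simp add: BijGroup_def)
  show "prime_autos \<noteq> {}"
    using card_prime_forms by (auto simp: prime_autos_eq)
next
  fix f assume "f \<in> prime_autos"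
  then obtain r r' where f: "f = replace_map r" and r: "prime_inverse r r'"
    by (rule prime_autosE)
  have r': "r' \<in> prime_forms"
    using r by (simp add: prime_inverse_def)
  interpret group "BijGroup CExtE"
    by (rule group_BijGroup)
  have Bij: "f \<in> Bij CExtE" "replace_map r' \<in> Bij CExtE"
    using \<open>f \<in> prime_autos\<close> prime_autos_Bij r' by (auto simp: prime_autos_eq)
  have "compose CExtE (replace_map r') f = (\<lambda>S \<in> CExtE. S)"
    using replace_logic_CExtE[OF r] replace_logic_inverse[OF prime_inverse_sym[OF r]]
    by (simp add: f compose_def replace_map_def cong: restrict_cong)
  with Bij have "inv\<^bsub>BijGroup CExtE\<^esub> f = replace_map r'"
    by (intro inv_equality) (simp_all add: BijGroup_def)
  then show "inv\<^bsub>BijGroup CExtE\<^esub> f \<in> prime_autos"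
    using r' by (auto simp: prime_autos_eq)
next
  fix f g assume *: "f \<in> prime_autos" "g \<in> prime_autos"
  then have "f \<otimes>\<^bsub>BijGroup CExtE\<^esub> g = compose CExtE f g"
    using prime_autos_Bij by (auto simp: BijGroup_def)
  then show "f \<otimes>\<^bsub>BijGroup CExtE\<^esub> g \<in> prime_autos"
    using * replace_map_compose by (auto simp: prime_autos_eq)
qed

section \<open>The isomorphism with the symmetric group\<close>

text \<open>The permutation is read off from the map alone, so no representing replacement has to be
  chosen.\<close>

definition point_perm :: "(fm set \<Rightarrow> fm set) \<Rightarrow> bool \<times> bool \<Rightarrow> bool \<times> bool"
  where "point_perm f s = (THE t. f (point_logic s) = point_logic t)"

lemma point_perm_eq: "f (point_logic s) = point_logic t \<Longrightarrow> point_perm f s = t"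
  unfolding point_perm_def by (auto simp: point_logic_inj)

text \<open>The inverse gives the right variance: sending the map to \<open>point_action r\<close>
  would reverse the order of composition.\<close>

lemma point_perm_replace_map:
  assumes "prime_inverse r r'"
  shows "point_perm (replace_map r) = point_action r'"
  by (intro ext point_perm_eq)
    (simp add: replace_map_def point_logic_CExtE replace_logic_point_logic[OF assms])

lemma point_perm_point_logic:
  assumes "f \<in> prime_autos"
  shows "f (point_logic s) = point_logic (point_perm f s)"
proof -
  obtain r r' where f: "f = replace_map r" and r: "prime_inverse r r'"
    using assms by (rule prime_autosE)
  show ?thesis
    unfolding f point_perm_replace_map[OF r]
    by (simp add: replace_map_def point_logic_CExtE replace_logic_point_logic[OF r])
qed

lemma point_perm_bij_betw: "bij_betw point_perm prime_autos {\<pi>. bij \<pi>}"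
proof (rule bij_betw_imageI)
  show "inj_on point_perm prime_autos"
  proof (rule inj_onI)
    fix f g assume *: "f \<in> prime_autos" "g \<in> prime_autos" "point_perm f = point_perm g"
    obtain q q' where f: "f = replace_map q" and q: "prime_inverse q q'"
      using *(1) by (rule prime_autosE)
    obtain r r' where g: "g = replace_map r" and r: "prime_inverse r r'"
      using *(2) by (rule prime_autosE)
    have "point_action q' = point_action r'"
      using *(3) unfolding f g point_perm_replace_map[OF q] point_perm_replace_map[OF r] .
    \<comment> \<open>Both actions are inverses of the same permutation; displayed forms with equal
      action coincide.\<close>
    then have "point_action q = point_action r"
      using prime_inverse_sym[OF q] prime_inverse_sym[OF r] by (simp add: prime_inverse_def)
    then show "f = g"
      using q r inj_onD[OF point_action_inj, of q r] by (simp add: f g prime_inverse_def)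
  qed
  have "point_perm ` prime_autos = point_action ` prime_forms"
  proof (intro equalityI subsetI; elim imageE)
    fix \<pi> f assume \<pi>: "\<pi> = point_perm f" and "f \<in> prime_autos"
    from this(2) obtain r r' where f: "f = replace_map r" and r: "prime_inverse r r'"
      by (rule prime_autosE)
    show "\<pi> \<in> point_action ` prime_forms"
      unfolding \<pi> f point_perm_replace_map[OF r]
      by (rule imageI) (use r in \<open>simp add: prime_inverse_def\<close>)
  next
    fix \<pi> r' assume \<pi>: "\<pi> = point_action r'" and "r' \<in> prime_forms"
    from this(2) obtain r where r: "prime_inverse r r'"
      using ex_prime_inverse prime_inverse_sym by blast
    show "\<pi> \<in> point_perm ` prime_autos"
      unfolding \<pi> point_perm_replace_map[OF r, symmetric]
      by (rule imageI) (use r in \<open>simp add: prime_autos_eq prime_inverse_def\<close>)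
  qed
  then show "point_perm ` prime_autos = {\<pi>. bij \<pi>}"
    by (simp add: point_action_image)
qed

lemma point_perm_compose:
  assumes "f \<in> prime_autos" "g \<in> prime_autos"
  shows "point_perm (compose CExtE f g) = point_perm f \<circ> point_perm g"
  by (intro ext point_perm_eq)
    (simp add: compose_def point_logic_CExtE point_perm_point_logic assms)

lemma prime_autos_iso: "BijGroup CExtE\<lparr>carrier := prime_autos\<rparr> \<cong> sym_group 4"
proof -
  have "card (UNIV :: (bool \<times> bool) set) = card {1..4::nat}"
    by (simp flip: UNIV_Times_UNIV)
  then obtain h :: "bool \<times> bool \<Rightarrow> nat" where h: "bij_betw h UNIV {1..4}"
    using finite_same_card_bij[of "UNIV :: (bool \<times> bool) set" "{1..4::nat}"] by auto
  \<comment> \<open>Conjugation by \<open>h\<close>, extended by the identity because a permutation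
    of \<open>{1..4}\<close> must fix all other numbers.\<close>
  define relabel where "relabel \<pi> i = (if i \<in> {1..4} then h (\<pi> (inv_into UNIV h i)) else i)" for \<pi> i
  have "bij_betw (relabel \<circ> point_perm) prime_autos {p. p permutes {1..4}}"
    using bij_betw_trans[OF point_perm_bij_betw[unfolded bij_eq_permutes] bij_betw_permutations[OF h]]
    unfolding relabel_def[abs_def] .
  moreover have "relabel (\<pi> \<circ> \<sigma>) = relabel \<pi> \<circ> relabel \<sigma>" for \<pi> \<sigma>
    using bij_betwE[OF h] bij_betw_imp_inj_on[OF h]
    by (auto simp: relabel_def fun_eq_iff simp del: atLeastAtMost_iff split_paired_All)
  then have "(relabel \<circ> point_perm) (f \<otimes>\<^bsub>BijGroup CExtE\<^esub> g)
      = (relabel \<circ> point_perm) f \<circ> (relabel \<circ> point_perm) g" if "f \<in> prime_autos" "g \<in> prime_autos" for f g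
    using that prime_autos_Bij by (simp add: BijGroup_def point_perm_compose subset_iff)
  ultimately have "relabel \<circ> point_perm \<in> iso (BijGroup CExtE\<lparr>carrier := prime_autos\<rparr>) (sym_group 4)"
    by (auto simp: iso_def hom_def sym_group_def dest: bij_betwE)
  then show ?thesis
    by (rule is_isoI)
qed

theorem theorem15:
  shows "(\<forall>\<rho> \<in> prime_UR.
            (\<forall>S \<in> CExtE. replace_logic \<rho> S \<in> CExtE) \<and>
            replace_map \<rho> \<in> lattice_auto CExtE_lattice) \<and>
         prime_autos \<subseteq> lattice_auto CExtE_lattice \<and>
         group (BijGroup CExtE\<lparr>carrier := prime_autos\<rparr>) \<and>
         BijGroup CExtE\<lparr>carrier := prime_autos\<rparr> \<cong> sym_group 4"
proof (intro conjI ballI)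
  show "replace_logic \<rho> S \<in> CExtE" if "\<rho> \<in> prime_UR" "S \<in> CExtE" for \<rho> S
    using that(1)
  proof (rule prime_UR_form)
    fix r assume "r \<in> prime_forms" "replace_logic \<rho> = replace_logic r"
    then show ?thesis
      using ex_prime_inverse replace_logic_CExtE that(2) by auto
  qed
  show "replace_map \<rho> \<in> lattice_auto CExtE_lattice" if "\<rho> \<in> prime_UR" for \<rho>
    using that prime_autos_lattice_auto by (auto simp: prime_autos_def)
  show "group (BijGroup CExtE\<lparr>carrier := prime_autos\<rparr>)"
    by (rule group.subgroup_imp_group[OF group_BijGroup prime_autos_subgroup])
qed (rule prime_autos_lattice_auto, rule prime_autos_iso)

end
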